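(* Let $H$ be a separable complex Hilbert space, let $T\in\mathcal{B}(H)$ be a normal operator that generates a unital $C^*$-algebra $\mathcal{A}$, and let $\mathcal{G}=\{T,TT^*\}$. Then $\mathcal{G}$ is a hyperrigid generator for the unital $C^*$-algebra $\mathcal{A}$.
   Context: Here $\mathcal{A}$ is the unital $C^*$-algebra generated by $T$, i.e. the smallest $C^*$-subalgebra of $\mathcal{B}(H)$ containing $T$ and the identity operator. UCP means unital completely positive. A finite or countably infinite set $\mathcal{G}$ of generators of a $C^*$-algebra $\mathcal{A}$ (for $\mathcal{A}$ considered as a unital $C^*$-algebra, generation is together with the unit) is called hyperrigid (a hyperrigid generator for $\mathcal{A}$) if for every faithful representation $\mathcal{A}\subseteq\mathcal{B}(L)$ on a Hilbert space $L$ and every sequence of UCP maps $\phi_n:\mathcal{B}(L)\to\mathcal{B}(L)$, $n=1,2,\dots$, $$\lim_{n\to\infty}\|\phi_n(g)-g\|=0\ \ \forall g\in\mathcal{G}\ \Longrightarrow\ \lim_{n\to\infty}\|\phi_n(a)-a\|=0\ \ \forall a\in\mathcal{A}.$$ Representations of unital $C^*$-algebras are understood to be nondegenerate (unital). *)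

theory Defs
  imports "HOL-Analysis.Analysis"
begin

section \<open>Complex Hilbert spaces\<close>

class complex_vector = real_vector +
  fixes scaleC :: "complex \<Rightarrow> 'a \<Rightarrow> 'a"  (infixr \<open>*\<^sub>C\<close> 75)
  assumes scaleC_add_right: "c *\<^sub>C (x + y) = c *\<^sub>C x + c *\<^sub>C y"
    and scaleC_add_left: "(c + d) *\<^sub>C x = c *\<^sub>C x + d *\<^sub>C x"
    and scaleC_scaleC: "c *\<^sub>C d *\<^sub>C x = (c * d) *\<^sub>C x"
    and scaleC_of_real: "complex_of_real r *\<^sub>C x = r *\<^sub>R x"

text \<open>
  The inner product \<open>cinner\<close> is linear in the first argument. The real inner product
  inherited from \<^class>\<open>real_inner\<close> is required to be its real part; since \<open>cinner x x\<close> is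
  real, the norm of \<^class>\<open>real_inner\<close> is the Hilbert space norm \<open>sqrt (cinner x x)\<close>, and
  positive definiteness is inherited as well.
\<close>

class chilbert_space = real_inner + complete_space + complex_vector +
  fixes cinner :: "'a \<Rightarrow> 'a \<Rightarrow> complex"
  assumes cinner_commute: "cinner x y = cnj (cinner y x)"
    and cinner_add_left: "cinner (x + y) z = cinner x z + cinner y z"
    and cinner_scaleC_left: "cinner (c *\<^sub>C x) y = c * cinner x y"
    and inner_eq_Re_cinner: "inner x y = Re (cinner x y)"

instance chilbert_space \<subseteq> banach ..

instantiation complex :: chilbert_space
begin

definition scaleC_complex :: "complex \<Rightarrow> complex \<Rightarrow> complex"
  where "scaleC_complex c x = c * x"

definition cinner_complex :: "complex \<Rightarrow> complex \<Rightarrow> complex"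
  where "cinner_complex x y = x * cnj y"

instance
  by standard
    (auto simp: scaleC_complex_def cinner_complex_def algebra_simps scaleR_conv_of_real
      inner_complex_def)

end

lemma scaleC_one [simp]: "1 *\<^sub>C x = (x :: 'a :: complex_vector)"
  using scaleC_of_real[of 1 x] by simp

lemma cinner_add_right: "cinner x (y + z) = cinner x y + cinner (x :: 'a :: chilbert_space) z"
  by (metis cinner_add_left cinner_commute complex_cnj_add)

lemma cinner_scaleC_right: "cinner x (c *\<^sub>C y) = cnj c * cinner (x :: 'a :: chilbert_space) y"
  by (metis cinner_commute cinner_scaleC_left complex_cnj_mult)

lemma Im_cinner: "Im (cinner x y) = - Re (cinner (\<i> *\<^sub>C x) (y :: 'a :: chilbert_space))"
  by (simp add: cinner_scaleC_left)

lemma cinner_eq_inner: "cinner x y = Complex (inner x y) (- inner (\<i> *\<^sub>C x) y)"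
  for x y :: "'a :: chilbert_space"
  by (simp add: complex_eq_iff inner_eq_Re_cinner Im_cinner[of x y])

lemma cinner_self: "cinner x x = complex_of_real ((norm x)\<^sup>2)"
  for x :: "'a :: chilbert_space"
proof -
  have "Im (cinner x x) = 0"
    using arg_cong[OF cinner_commute[of x x], of Im] by simp
  thus ?thesis
    by (simp add: complex_eq_iff power2_norm_eq_inner inner_eq_Re_cinner)
qed

lemma norm_scaleC: "norm (c *\<^sub>C x) = cmod c * norm (x :: 'a :: chilbert_space)"
proof -
  have "complex_of_real ((norm (c *\<^sub>C x))\<^sup>2) = cinner (c *\<^sub>C x) (c *\<^sub>C x)"
    by (rule cinner_self[symmetric])
  also have "\<dots> = (c * cnj c) * complex_of_real ((norm x)\<^sup>2)"
    by (subst cinner_scaleC_left, subst cinner_scaleC_right, subst cinner_self)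
      (simp only: mult.assoc)
  also have "\<dots> = complex_of_real ((cmod c * norm x)\<^sup>2)"
    by (simp only: complex_norm_square[symmetric] of_real_mult[symmetric] power_mult_distrib)
  finally have "(norm (c *\<^sub>C x))\<^sup>2 = (cmod c * norm x)\<^sup>2"
    by (simp only: of_real_eq_iff)
  thus ?thesis
    by (simp add: power2_eq_iff_nonneg)
qed

lemma bounded_linear_scaleC: "bounded_linear (\<lambda>x :: 'a :: chilbert_space. c *\<^sub>C x)"
proof (rule bounded_linear_intro[where K = "cmod c"])
  fix r :: real and x y :: 'a
  show "c *\<^sub>C (x + y) = c *\<^sub>C x + c *\<^sub>C y"
    by (rule scaleC_add_right)
  show "c *\<^sub>C r *\<^sub>R x = r *\<^sub>R c *\<^sub>C x"
    unfolding scaleC_of_real[symmetric] by (simp add: scaleC_scaleC mult.commute)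
  show "norm (c *\<^sub>C x) \<le> norm x * cmod c"
    by (simp add: norm_scaleC)
qed


lemma
  fixes x y :: "'a :: chilbert_space"
  shows scaleC_zero_right [simp]: "c *\<^sub>C (0 :: 'a) = 0"
    and scaleC_minus_right: "c *\<^sub>C (- x) = - (c *\<^sub>C x)"
    and scaleC_diff_right: "c *\<^sub>C (x - y) = c *\<^sub>C x - c *\<^sub>C y"
    and scaleC_scaleR: "c *\<^sub>C r *\<^sub>R x = r *\<^sub>R c *\<^sub>C x"
proof -
  interpret bounded_linear "\<lambda>x :: 'a. c *\<^sub>C x"
    by (rule bounded_linear_scaleC)
  show "c *\<^sub>C (0 :: 'a) = 0" "c *\<^sub>C (- x) = - (c *\<^sub>C x)"
    "c *\<^sub>C (x - y) = c *\<^sub>C x - c *\<^sub>C y" "c *\<^sub>C r *\<^sub>R x = r *\<^sub>R c *\<^sub>C x"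
    by (rule zero neg diff scaleR)+
qed


section \<open>The algebra of bounded operators\<close>

text \<open>
  \<open>'a bop\<close> is the set of bounded complex-linear operators on the Hilbert space \<open>'a\<close>. On it,
  \<open>*\<close> is composition, \<open>1\<close> the identity and \<open>norm\<close> the operator norm.
\<close>

typedef (overloaded) 'a bop =
  "{A :: 'a::chilbert_space \<Rightarrow>\<^sub>L 'a. \<forall>c x. blinfun_apply A (c *\<^sub>C x) = c *\<^sub>C blinfun_apply A x}"
  morphisms blinfun_of_bop bop_of_blinfun
proof
  show "id_blinfun \<in> {A :: 'a \<Rightarrow>\<^sub>L 'a. \<forall>c x. A (c *\<^sub>C x) = c *\<^sub>C A x}"
    by simp
qed

setup_lifting type_definition_bop

lift_definition bop_apply :: "'a::chilbert_space bop \<Rightarrow> 'a \<Rightarrow> 'a" is blinfun_apply .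

lemma bop_eqI: "(\<And>x. bop_apply A x = bop_apply B x) \<Longrightarrow> A = B"
  by transfer (rule blinfun_eqI)

lemma bounded_linear_bop_apply: "bounded_linear (bop_apply A)"
  by transfer (rule blinfun.bounded_linear_right)

lemma bop_apply_scaleC: "bop_apply A (c *\<^sub>C x) = c *\<^sub>C bop_apply A x"
  by transfer simp

instantiation bop :: (chilbert_space) real_normed_algebra
begin

lift_definition norm_bop :: "'a bop \<Rightarrow> real" is norm .
lift_definition zero_bop :: "'a bop" is 0
  by simp
lift_definition plus_bop :: "'a bop \<Rightarrow> 'a bop \<Rightarrow> 'a bop" is "(+)"
  by (simp add: blinfun.add_left scaleC_add_right)
lift_definition uminus_bop :: "'a bop \<Rightarrow> 'a bop" is uminus
  by (simp add: blinfun.minus_left scaleC_minus_right)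
lift_definition minus_bop :: "'a bop \<Rightarrow> 'a bop \<Rightarrow> 'a bop" is "(-)"
  by (simp add: blinfun.diff_left scaleC_diff_right)
lift_definition scaleR_bop :: "real \<Rightarrow> 'a bop \<Rightarrow> 'a bop" is scaleR
  by (simp add: blinfun.scaleR_left scaleC_scaleR)
lift_definition times_bop :: "'a bop \<Rightarrow> 'a bop \<Rightarrow> 'a bop" is blinfun_compose
  by simp

definition dist_bop :: "'a bop \<Rightarrow> 'a bop \<Rightarrow> real"
  where "dist_bop A B = norm (A - B)"

definition sgn_bop :: "'a bop \<Rightarrow> 'a bop"
  where "sgn_bop A = scaleR (inverse (norm A)) A"

definition uniformity_bop :: "('a bop \<times> 'a bop) filter"
  where "uniformity_bop = (INF e\<in>{0 <..}. principal {(A, B). dist A B < e})"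

definition open_bop :: "'a bop set \<Rightarrow> bool"
  where "open_bop S = (\<forall>A\<in>S. \<forall>\<^sub>F (A', B) in uniformity. A' = A \<longrightarrow> B \<in> S)"

instance
proof
  fix A B C :: "'a bop" and r s :: real
  show "A + B + C = A + (B + C)" "A + B = B + A" "0 + A = A" "- A + A = 0" "A - B = A + - B"
    "r *\<^sub>R (A + B) = r *\<^sub>R A + r *\<^sub>R B" "(r + s) *\<^sub>R A = r *\<^sub>R A + s *\<^sub>R A"
    "r *\<^sub>R s *\<^sub>R A = (r * s) *\<^sub>R A" "1 *\<^sub>R A = A"
    by (transfer, simp add: algebra_simps)+
  show "A * B * C = A * (B * C)" "(A + B) * C = A * C + B * C" "A * (B + C) = A * B + A * C"
    "r *\<^sub>R A * B = r *\<^sub>R (A * B)" "A * r *\<^sub>R B = r *\<^sub>R (A * B)"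
    by (transfer, rule blinfun_eqI, simp add: blinfun.bilinear_simps)+
  show "dist A B = norm (A - B)" by (rule dist_bop_def)
  show "sgn A = inverse (norm A) *\<^sub>R A" by (rule sgn_bop_def)
  show "(uniformity :: ('a bop \<times> 'a bop) filter) = (INF e\<in>{0 <..}. principal {(A, B). dist A B < e})"
    by (rule uniformity_bop_def)
  show "open S = (\<forall>A\<in>S. \<forall>\<^sub>F (A', B) in uniformity. A' = A \<longrightarrow> B \<in> S)" for S :: "'a bop set"
    by (rule open_bop_def)
  show "norm A = 0 \<longleftrightarrow> A = 0" "norm (A + B) \<le> norm A + norm B" "norm (r *\<^sub>R A) = \<bar>r\<bar> * norm A"
    by (transfer, simp add: norm_triangle_ineq)+
  show "norm (A * B) \<le> norm A * norm B"
    by transfer (rule norm_blinfun_compose)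
qed

end

instantiation bop :: (chilbert_space) monoid_mult
begin

lift_definition one_bop :: "'a bop" is id_blinfun by simp

instance
  by standard (transfer, rule blinfun_eqI, simp)+

end

instantiation bop :: (chilbert_space) complex_vector
begin

lift_definition scaleC_bop :: "complex \<Rightarrow> 'a bop \<Rightarrow> 'a bop"
  is "\<lambda>c A. blinfun_compose (Blinfun (\<lambda>x. c *\<^sub>C x)) A"
  by (simp add: bounded_linear_Blinfun_apply[OF bounded_linear_scaleC] scaleC_scaleC mult.commute)

instance
  by standard
    (transfer, rule blinfun_eqI,
      simp add: bounded_linear_Blinfun_apply[OF bounded_linear_scaleC] blinfun.bilinear_simps
        scaleC_add_right scaleC_add_left scaleC_scaleC scaleC_of_real)+

end

lemma bop_apply_simps [simp]:
  "bop_apply 0 x = 0" "bop_apply 1 x = x"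
  "bop_apply (A + B) x = bop_apply A x + bop_apply B x"
  "bop_apply (A - B) x = bop_apply A x - bop_apply B x"
  "bop_apply (- A) x = - bop_apply A x"
  "bop_apply (A * B) x = bop_apply A (bop_apply B x)"
  "bop_apply (r *\<^sub>R A) x = r *\<^sub>R bop_apply A x"
  "bop_apply (c *\<^sub>C A) x = c *\<^sub>C bop_apply A x"
  by (transfer, simp add: blinfun.bilinear_simps
      bounded_linear_Blinfun_apply[OF bounded_linear_scaleC])+

lemma norm_bop_eq_onorm: "norm A = onorm (bop_apply A)"
  by transfer (simp add: norm_blinfun.rep_eq)

lemma norm_bop_apply: "norm (bop_apply A x) \<le> norm A * norm x"
  by transfer (rule norm_blinfun)

instance bop :: (chilbert_space) banach
proof
  fix X :: "nat \<Rightarrow> 'a bop"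
  assume X: "Cauchy X"
  have dist: "dist (blinfun_of_bop A) (blinfun_of_bop B) = dist A B" for A B :: "'a bop"
    by (simp add: dist_norm norm_bop.rep_eq minus_bop.rep_eq)
  have "Cauchy (\<lambda>n. blinfun_of_bop (X n))"
    using X by (simp add: Cauchy_def dist)
  hence "convergent (\<lambda>n. blinfun_of_bop (X n))"
    by (rule Cauchy_convergent)
  then obtain A where A: "(\<lambda>n. blinfun_of_bop (X n)) \<longlonglongrightarrow> A"
    unfolding convergent_def by (rule exE)
  have lim: "(\<lambda>n. bop_apply (X n) x) \<longlonglongrightarrow> A x" for x
    unfolding bop_apply.rep_eq by (rule bounded_linear.tendsto[OF blinfun.bounded_linear_left A])
  have "A (c *\<^sub>C x) = c *\<^sub>C A x" for c x
    using lim[of "c *\<^sub>C x"] bounded_linear.tendsto[OF bounded_linear_scaleC lim, of c x]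
    unfolding bop_apply_scaleC by (rule LIMSEQ_unique)
  hence "blinfun_of_bop (bop_of_blinfun A) = A"
    by (intro bop_of_blinfun_inverse) simp
  hence "(\<lambda>n. blinfun_of_bop (X n)) \<longlonglongrightarrow> blinfun_of_bop (bop_of_blinfun A)"
    using A by simp
  hence "X \<longlonglongrightarrow> bop_of_blinfun A"
    by (simp add: lim_sequentially dist)
  thus "convergent X"
    by (rule convergentI)
qed


section \<open>Adjoints\<close>

definition adj :: "'a::chilbert_space bop \<Rightarrow> 'a bop"  (\<open>_\<^sup>\<star>\<close> [1000] 999)
  where "A\<^sup>\<star> = (THE B. \<forall>x y. cinner (bop_apply A x) y = cinner x (bop_apply B y))"

lemma riesz_representation_real:
  fixes f :: "'a :: {real_inner, complete_space} \<Rightarrow> real"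
  assumes f: "bounded_linear f"
  obtains z where "\<And>x. f x = inner x z"
proof -
  interpret bounded_linear f by (rule f)
  define Q where "Q x = (norm x)\<^sup>2 - 2 * f x" for x
  obtain K where K: "\<And>x. \<bar>f x\<bar> \<le> norm x * K"
    using bounded by auto
  have low: "- K\<^sup>2 \<le> Q x" for x
  proof -
    have "0 \<le> (norm x - K)\<^sup>2" by simp
    thus ?thesis using K[of x] by (auto simp: Q_def power2_diff mult.commute)
  qed
  define m where "m = (INF x. Q x)"
  have bdd: "bdd_below (range Q)"
    using low by (auto intro!: bdd_belowI)
  have m: "m \<le> Q x" for x
    unfolding m_def by (rule cINF_lower[OF bdd]) simp
  have par: "(norm (x - y))\<^sup>2 = 2 * Q x + 2 * Q y - 4 * Q ((1/2) *\<^sub>R (x + y))" for x y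
    by (simp add: Q_def power2_norm_eq_inner algebra_simps scaleR add inner_add_left
        inner_add_right inner_diff_left inner_diff_right inner_commute)
  have "\<exists>x. Q x < m + 1 / Suc n" for n
    using cINF_less_iff[OF _ bdd, of "m + 1 / Suc n"] by (auto simp: m_def)
  then obtain s where s: "\<And>n. Q (s n) < m + 1 / Suc n"
    by metis
  have Cs: "Cauchy s"
  proof (rule metric_CauchyI)
    fix e :: real assume e: "0 < e"
    then obtain M where M: "inverse (real (Suc M)) < e\<^sup>2 / 4"
      using reals_Archimedean[of "e\<^sup>2 / 4"] by auto
    show "\<exists>M. \<forall>k\<ge>M. \<forall>n\<ge>M. dist (s k) (s n) < e"
    proof (intro exI allI impI)
      fix k n assume kn: "M \<le> k" "M \<le> n"
      have le: "1 / real (Suc j) \<le> inverse (real (Suc M))" if "M \<le> j" for j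
        using that by (simp add: field_simps)
      have "(norm (s k - s n))\<^sup>2 < e\<^sup>2"
        using s[of k] s[of n] m[of "(1/2) *\<^sub>R (s k + s n)"] par[of "s k" "s n"]
          le[OF kn(1)] le[OF kn(2)] M by linarith
      thus "dist (s k) (s n) < e"
        using e by (simp add: dist_norm power2_less_imp_less)
    qed
  qed
  then obtain z where z: "s \<longlonglongrightarrow> z"
    using Cauchy_convergent convergent_def by blast
  have "(\<lambda>n. Q (s n)) \<longlonglongrightarrow> Q z"
    unfolding Q_def by (intro tendsto_intros z tendsto[OF z])
  moreover have "(\<lambda>n. m + 1 / Suc n) \<longlonglongrightarrow> m + 0"
    by (intro tendsto_intros LIMSEQ_Suc[OF lim_1_over_n])
  ultimately have "Q z \<le> m"
    using s LIMSEQ_le[of "\<lambda>n. Q (s n)" "Q z" "\<lambda>n. m + 1 / Suc n" m] by (force intro: less_imp_le)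
  hence min: "Q z \<le> Q x" for x
    using m[of x] by linarith
  have "f x = inner x z" for x
  proof -
    define d where "d = inner x z - f x"
    have ge: "0 \<le> t * (2 * d) + t\<^sup>2 * (norm x)\<^sup>2" for t
    proof -
      have "(norm (z + t *\<^sub>R x))\<^sup>2 = (norm z)\<^sup>2 + 2 * t * inner x z + t\<^sup>2 * (norm x)\<^sup>2"
        unfolding power2_norm_eq_inner
        by (simp add: inner_add_left inner_add_right inner_commute power2_eq_square algebra_simps)
      thus ?thesis
        using min[of "z + t *\<^sub>R x"] by (simp add: Q_def d_def add scaleR algebra_simps)
    qed
    define N where "N = 1 + (norm x)\<^sup>2"
    have N: "0 < N" and nx: "(norm x)\<^sup>2 = N - 1"
      by (simp_all add: N_def add_pos_nonneg)
    have "0 \<le> (- d / N) * (2 * d) + (- d / N)\<^sup>2 * (norm x)\<^sup>2"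
      by (rule ge)
    also have "\<dots> = - (d\<^sup>2 * (1 + N)) / N\<^sup>2"
      using N unfolding nx by (simp add: field_simps power2_eq_square)
    finally have "d\<^sup>2 * (1 + N) \<le> 0"
      using N by (simp add: field_simps zero_le_divide_iff)
    hence "d = 0"
      using N by (simp add: mult_le_0_iff)
    thus ?thesis by (simp add: d_def)
  qed
  thus thesis by (rule that)
qed

lemma bop_adjoint_exists:
  "\<exists>B. \<forall>x y. cinner (bop_apply A x) y = cinner x (bop_apply B y)"
proof -
  have ex: "\<exists>z. \<forall>x. cinner (bop_apply A x) y = cinner x z" for y
  proof -
    have "bounded_linear (\<lambda>x. inner (bop_apply A x) y)"
      by (rule bounded_linear_inner_left_comp[OF bounded_linear_bop_apply])
    then obtain z where z: "\<And>x. inner (bop_apply A x) y = inner x z"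
      using riesz_representation_real by blast
    show ?thesis
      by (intro exI[of _ z] allI)
        (simp add: cinner_eq_inner z flip: bop_apply_scaleC)
  qed
  then obtain g where g: "\<And>x y. cinner (bop_apply A x) y = cinner x (g y)"
    by metis
  have eqI: "u = v" if "\<And>x. cinner x u = cinner x v" for u v :: 'a
  proof -
    have "inner (u - v) (u - v) = inner (u - v) u - inner (u - v) v"
      by (rule inner_diff_right)
    also have "\<dots> = 0"
      by (simp add: inner_eq_Re_cinner that)
    finally show ?thesis by simp
  qed
  have add: "g (x + y) = g x + g y" for x y
    by (rule eqI) (simp add: cinner_add_right flip: g)
  have scale: "g (c *\<^sub>C x) = c *\<^sub>C g x" for c x
    by (rule eqI) (simp add: cinner_scaleC_right flip: g)
  have bound: "norm (g y) \<le> norm y * norm A" for y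
  proof (cases "g y = 0")
    case False
    have "norm (g y) * norm (g y) = inner (g y) (g y)"
      by (simp add: power2_norm_eq_inner flip: power2_eq_square)
    also have "\<dots> = inner (bop_apply A (g y)) y"
      by (simp add: inner_eq_Re_cinner g)
    also have "\<dots> \<le> norm (bop_apply A (g y)) * norm y"
      by (rule norm_cauchy_schwarz)
    also have "\<dots> \<le> norm A * norm (g y) * norm y"
      by (intro mult_right_mono norm_bop_apply) simp
    finally show ?thesis
      using False by (simp add: mult.commute mult.left_commute)
  qed simp
  have bl: "bounded_linear g"
    by (rule bounded_linear_intro[OF add _ bound]) (simp add: scale flip: scaleC_of_real)
  define B where "B = bop_of_blinfun (Blinfun g)"
  have "bop_apply B = g"
    unfolding B_def bop_apply.rep_eq
    by (subst bop_of_blinfun_inverse) (simp_all add: bounded_linear_Blinfun_apply[OF bl] scale)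
  thus ?thesis using g by auto
qed

lemma cinner_adj: "cinner (bop_apply A x) y = cinner x (bop_apply (A\<^sup>\<star>) y)"
proof -
  obtain B where B: "\<forall>x y. cinner (bop_apply A x) y = cinner x (bop_apply B y)"
    using bop_adjoint_exists by blast
  have "A\<^sup>\<star> = B"
    unfolding adj_def
  proof (rule the_equality, rule B)
    fix C assume C: "\<forall>x y. cinner (bop_apply A x) y = cinner x (bop_apply C y)"
    show "C = B"
    proof (rule bop_eqI)
      fix y
      let ?d = "bop_apply C y - bop_apply B y"
      have "inner ?d ?d = inner ?d (bop_apply C y) - inner ?d (bop_apply B y)"
        by (rule inner_diff_right)
      also have "\<dots> = 0"
        using B C by (metis diff_self inner_eq_Re_cinner)
      finally show "bop_apply C y = bop_apply B y" by simp
    qed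
  qed
  with B show ?thesis by blast
qed

definition normal_bop :: "'a::chilbert_space bop \<Rightarrow> bool"
  where "normal_bop T \<longleftrightarrow> T * T\<^sup>\<star> = T\<^sup>\<star> * T"


section \<open>C*-subalgebras and representations\<close>

definition unital_cstar_subalgebra :: "'a::chilbert_space bop set \<Rightarrow> bool"
  where "unital_cstar_subalgebra \<A> \<longleftrightarrow>
    1 \<in> \<A> \<and> (\<forall>a\<in>\<A>. \<forall>b\<in>\<A>. a + b \<in> \<A>) \<and> (\<forall>a\<in>\<A>. \<forall>b\<in>\<A>. a * b \<in> \<A>) \<and>
    (\<forall>c. \<forall>a\<in>\<A>. c *\<^sub>C a \<in> \<A>) \<and> (\<forall>a\<in>\<A>. a\<^sup>\<star> \<in> \<A>) \<and> closed \<A>"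

definition unital_cstar_generated :: "'a::chilbert_space bop set \<Rightarrow> 'a bop set"
  where "unital_cstar_generated S = \<Inter>{\<A>. unital_cstar_subalgebra \<A> \<and> S \<subseteq> \<A>}"

text \<open>Only the values of \<open>\<pi>\<close> on \<open>\<A>\<close> matter.\<close>

definition unital_representation ::
    "'h::chilbert_space bop set \<Rightarrow> ('h bop \<Rightarrow> 'l::chilbert_space bop) \<Rightarrow> bool"
  where "unital_representation \<A> \<pi> \<longleftrightarrow>
    \<pi> 1 = 1 \<and>
    (\<forall>a\<in>\<A>. \<forall>b\<in>\<A>. \<pi> (a + b) = \<pi> a + \<pi> b) \<and>
    (\<forall>a\<in>\<A>. \<forall>b\<in>\<A>. \<pi> (a * b) = \<pi> a * \<pi> b) \<and>
    (\<forall>c. \<forall>a\<in>\<A>. \<pi> (c *\<^sub>C a) = c *\<^sub>C \<pi> a) \<and>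
    (\<forall>a\<in>\<A>. \<pi> (a\<^sup>\<star>) = (\<pi> a)\<^sup>\<star>)"

definition faithful_representation ::
    "'h::chilbert_space bop set \<Rightarrow> ('h bop \<Rightarrow> 'l::chilbert_space bop) \<Rightarrow> bool"
  where "faithful_representation \<A> \<pi> \<longleftrightarrow> unital_representation \<A> \<pi> \<and> inj_on \<pi> \<A>"


section \<open>UCP maps and hyperrigidity\<close>

text \<open>
  Positivity of an \<open>n \<times> n\<close> matrix of operators on \<open>'l\<close>, viewed as an operator on the
  \<open>n\<close>-fold direct sum of \<open>'l\<close>: \<open>\<langle>M x, x\<rangle> \<ge> 0\<close> for all \<open>x = (x 0, \<dots>, x (n - 1))\<close>.
  Entries with an index \<open>\<ge> n\<close> are ignored.
\<close>

definition positive_bop_matrix :: "nat \<Rightarrow> (nat \<Rightarrow> nat \<Rightarrow> 'l::chilbert_space bop) \<Rightarrow> bool"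
  where "positive_bop_matrix n M \<longleftrightarrow>
    (\<forall>x :: nat \<Rightarrow> 'l. (\<Sum>i<n. cinner (\<Sum>j<n. bop_apply (M i j) (x j)) (x i)) \<in> \<real>\<^sub>\<ge>\<^sub>0)"

definition completely_positive :: "('l::chilbert_space bop \<Rightarrow> 'l bop) \<Rightarrow> bool"
  where "completely_positive \<phi> \<longleftrightarrow>
    (\<forall>n M. positive_bop_matrix n M \<longrightarrow> positive_bop_matrix n (\<lambda>i j. \<phi> (M i j)))"

definition ucp :: "('l::chilbert_space bop \<Rightarrow> 'l bop) \<Rightarrow> bool"
  where "ucp \<phi> \<longleftrightarrow>
    (\<forall>a b. \<phi> (a + b) = \<phi> a + \<phi> b) \<and> (\<forall>c a. \<phi> (c *\<^sub>C a) = c *\<^sub>C \<phi> a) \<and>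
    \<phi> 1 = 1 \<and> completely_positive \<phi>"

text \<open>
  HOL has no quantification over types inside a formula, so the Hilbert spaces on which the
  C*-algebra is represented enter through the type argument \<open>'l\<close>. The notion of hyperrigidity is
  the conjunction of all its instances: a theorem with conclusion
  \<open>hyperrigid_generator TYPE('l) \<G> \<A>\<close> and \<open>'l\<close> a type variable occurring nowhere else.
\<close>

definition hyperrigid_generator ::
    "'l::chilbert_space itself \<Rightarrow> 'h::chilbert_space bop set \<Rightarrow> 'h bop set \<Rightarrow> bool"
  where "hyperrigid_generator L \<G> \<A> \<longleftrightarrow>
    countable \<G> \<and> unital_cstar_generated \<G> = \<A> \<and>
    (\<forall>(\<pi> :: 'h bop \<Rightarrow> 'l bop) (\<phi> :: nat \<Rightarrow> 'l bop \<Rightarrow> 'l bop).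
      faithful_representation \<A> \<pi> \<longrightarrow> (\<forall>n. ucp (\<phi> n)) \<longrightarrow>
      (\<forall>g\<in>\<G>. (\<lambda>n. norm (\<phi> n (\<pi> g) - \<pi> g)) \<longlonglongrightarrow> 0) \<longrightarrow>
      (\<forall>a\<in>\<A>. (\<lambda>n. norm (\<phi> n (\<pi> a) - \<pi> a)) \<longlonglongrightarrow> 0))"

end

theory Submission
  imports Defs
begin

text \<open>
  Complete positivity yields
  \<open>\<parallel>\<phi>(x y) - \<phi>(x) \<phi>(y)\<parallel>\<^sup>2 \<le> \<parallel>\<phi>(x x\<^sup>\<star>) - \<phi>(x) \<phi>(x\<^sup>\<star>)\<parallel> \<parallel>y\<parallel>\<^sup>2\<close>. If \<open>t\<close> is normal and \<open>\<phi>\<^sub>n\<close>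
  converges at \<open>t\<close> and \<open>t t\<^sup>\<star>\<close>, the right-hand side tends to \<open>0\<close> for \<open>x = t\<close> and, by normality,
  for \<open>x = t\<^sup>\<star>\<close>. So both lie in the set of all \<open>a\<close> with \<open>\<phi>\<^sub>n(a y) - a \<phi>\<^sub>n(y) \<rightarrow> 0\<close> for every \<open>y\<close>,
  which is a closed unital algebra; \<open>y = 1\<close> gives convergence at each of its elements. To transfer
  this along a representation \<open>\<pi>\<close> one needs that \<open>\<pi>\<close> is contractive: for \<open>\<parallel>a\<parallel> < 1\<close>, the algebra
  contains a self-adjoint \<open>b\<close> with \<open>b\<^sup>2 = 1 - a\<^sup>\<star> a\<close>, whence \<open>1 - \<pi>(a)\<^sup>\<star> \<pi>(a) = \<pi>(b)\<^sup>\<star> \<pi>(b) \<ge> 0\<close>.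
\<close>

section \<open>Adjoints and operator norms\<close>

lemma inner_bop_adj: "inner (bop_apply A x) y = inner x (bop_apply (A\<^sup>\<star>) y)"
  by (simp add: inner_eq_Re_cinner cinner_adj)

text \<open>The real inner product already separates vectors, so only real parts of the hypothesis
  are compared. The algebraic rules for the adjoint follow by verifying its defining
  identity.\<close>

lemma adj_unique:
  assumes "\<And>x y. cinner (bop_apply A x) y = cinner x (bop_apply B y)"
  shows "A\<^sup>\<star> = B"
proof (rule bop_eqI)
  fix y
  have "inner x (bop_apply (A\<^sup>\<star>) y) = inner x (bop_apply B y)" for x
    using assms[of x y] by (simp add: inner_eq_Re_cinner cinner_adj)
  thus "bop_apply (A\<^sup>\<star>) y = bop_apply B y"
    by (metis vector_eq_rdot inner_commute)
qed

lemma cinner_adj_right: "cinner x (bop_apply A y) = cinner (bop_apply (A\<^sup>\<star>) x) y"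
  by (metis cinner_adj cinner_commute)

lemma adj_adj [simp]: "(A\<^sup>\<star>)\<^sup>\<star> = A"
  by (rule adj_unique) (simp add: cinner_adj_right)

lemma adj_one [simp]: "1\<^sup>\<star> = 1"
  by (rule adj_unique) simp

lemma adj_add: "(A + B)\<^sup>\<star> = A\<^sup>\<star> + B\<^sup>\<star>"
  by (rule adj_unique) (simp add: cinner_add_left cinner_add_right cinner_adj)

lemma adj_mult: "(A * B)\<^sup>\<star> = B\<^sup>\<star> * A\<^sup>\<star>"
  by (rule adj_unique) (simp add: cinner_adj)

lemma adj_scaleC: "(c *\<^sub>C A)\<^sup>\<star> = cnj c *\<^sub>C A\<^sup>\<star>"
  by (rule adj_unique) (simp add: cinner_scaleC_left cinner_scaleC_right cinner_adj)

lemma adj_scaleR: "(r *\<^sub>R A)\<^sup>\<star> = r *\<^sub>R A\<^sup>\<star>"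
  using adj_scaleC[of "complex_of_real r" A] by (simp add: scaleC_of_real)

lemma adj_diff: "(A - B)\<^sup>\<star> = A\<^sup>\<star> - B\<^sup>\<star>"
  using adj_add[of A "(- 1) *\<^sub>R B"] unfolding adj_scaleR by simp

lemma norm_bop_le:
  assumes "0 \<le> K" "\<And>x. norm (bop_apply A x) \<le> K * norm x"
  shows "norm A \<le> K"
  unfolding norm_bop_eq_onorm using assms by (rule onorm_bound)

lemma inner_adj_self: "inner (bop_apply (A\<^sup>\<star> * A) x) x = (norm (bop_apply A x))\<^sup>2"
  by (metis bop_apply_simps(6) inner_bop_adj inner_commute power2_norm_eq_inner)

text \<open>Cauchy-Schwarz for \<open>A\<close> applied to \<open>?z\<close>, paired with
  \<open>y\<close>, bounds the square of \<open>norm ?z\<close>; one factor is then cancelled.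
  Equality follows by applying this to the adjoint as well.\<close>

lemma norm_adj_le: "norm (A\<^sup>\<star>) \<le> norm A"
proof (rule norm_bop_le)
  fix y
  let ?z = "bop_apply (A\<^sup>\<star>) y"
  have "norm ?z * norm ?z = inner (bop_apply A ?z) y"
    by (simp add: inner_bop_adj power2_norm_eq_inner flip: power2_eq_square)
  also have "\<dots> \<le> (norm A * norm ?z) * norm y"
    by (rule order_trans[OF norm_cauchy_schwarz]) (intro mult_right_mono norm_bop_apply norm_ge_zero)
  finally have "norm ?z * norm ?z \<le> norm ?z * (norm A * norm y)"
    by (simp add: ac_simps)
  thus "norm ?z \<le> norm A * norm y"
    by (cases "?z = 0") auto
qed simp

lemma norm_adj [simp]: "norm (A\<^sup>\<star>) = norm A"
  using norm_adj_le[of A] norm_adj_le[of "A\<^sup>\<star>"] by simp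

lemma bounded_linear_adj: "bounded_linear adj"
  by (rule bounded_linear_intro[where K = 1]) (simp_all add: adj_add adj_scaleR)

lemma scaleC_mult_left: "(c *\<^sub>C A) * B = c *\<^sub>C (A * B)"
  for A B :: "'a::chilbert_space bop"
  by (rule bop_eqI) simp

lemma norm_scaleC_bop: "norm (c *\<^sub>C A) \<le> cmod c * norm A"
  for A :: "'a::chilbert_space bop"
proof (rule norm_bop_le)
  fix x
  show "norm (bop_apply (c *\<^sub>C A) x) \<le> cmod c * norm A * norm x"
    by (simp add: norm_scaleC mult.assoc mult_left_mono norm_bop_apply)
qed simp

lemma scaleC_diff_right_bop: "c *\<^sub>C (A - B) = c *\<^sub>C A - c *\<^sub>C B"
  for A B :: "'a::chilbert_space bop"
  by (rule bop_eqI) (simp add: scaleC_diff_right)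

section \<open>C*-subalgebras\<close>

lemma cstar_subalgebraD:
  assumes "unital_cstar_subalgebra \<A>"
  shows "1 \<in> \<A>" "closed \<A>" "a \<in> \<A> \<Longrightarrow> a\<^sup>\<star> \<in> \<A>" "a \<in> \<A> \<Longrightarrow> c *\<^sub>C a \<in> \<A>"
    "a \<in> \<A> \<Longrightarrow> b \<in> \<A> \<Longrightarrow> a + b \<in> \<A>" "a \<in> \<A> \<Longrightarrow> b \<in> \<A> \<Longrightarrow> a * b \<in> \<A>"
  using assms unfolding unital_cstar_subalgebra_def by auto

lemma cstar_subalgebra_scaleR:
  assumes "unital_cstar_subalgebra \<A>" "a \<in> \<A>"
  shows "r *\<^sub>R a \<in> \<A>"
  using cstar_subalgebraD(4)[OF assms, of "complex_of_real r"] by (simp add: scaleC_of_real)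

lemma cstar_subalgebra_diff:
  assumes "unital_cstar_subalgebra \<A>" "a \<in> \<A>" "b \<in> \<A>"
  shows "a - b \<in> \<A>"
  using cstar_subalgebraD(5)[OF assms(1,2) cstar_subalgebra_scaleR[OF assms(1,3), of "- 1"]] by simp

lemma cstar_subalgebra_generated: "unital_cstar_subalgebra (unital_cstar_generated S)"
  unfolding unital_cstar_generated_def
  by (subst unital_cstar_subalgebra_def) (auto simp: cstar_subalgebraD)

lemma generated_superset: "S \<subseteq> unital_cstar_generated S"
  unfolding unital_cstar_generated_def by blast

lemma generated_minimal:
  "unital_cstar_subalgebra \<A> \<Longrightarrow> S \<subseteq> \<A> \<Longrightarrow> unital_cstar_generated S \<subseteq> \<A>"
  unfolding unital_cstar_generated_def by blast

text \<open>Each algebra contains the generators of the other. This is what allows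
  \<open>T * T\<^sup>\<star>\<close> to be added to the generator \<open>T\<close>.\<close>

lemma generated_insert:
  assumes "a \<in> unital_cstar_generated S"
  shows "unital_cstar_generated (insert a S) = unital_cstar_generated S"
  using assms generated_superset[of "insert a S"] generated_superset[of S]
  by (intro antisym generated_minimal cstar_subalgebra_generated) auto

text \<open>
  The root is \<open>1 - y\<close> for the fixed point \<open>y = (x + y\<^sup>2) / 2\<close>; the radius \<open>\<rho>\<close> is the fixed point of the
  scalar map \<open>r \<mapsto> (\<parallel>x\<parallel> + r\<^sup>2) / 2\<close>.
\<close>

lemma cstar_subalgebra_sqrt_one_minus:
  assumes \<A>: "unital_cstar_subalgebra \<A>"
    and x: "x \<in> \<A>" "x\<^sup>\<star> = x" "norm x < 1"
  obtains b where "b \<in> \<A>" "b\<^sup>\<star> = b" "b * b = 1 - x"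
proof -
  define \<rho> where "\<rho> = 1 - sqrt (1 - norm x)"
  define f where "f y = (1/2) *\<^sub>R (x + y * y)" for y
  define S where "S = \<A> \<inter> {y. y\<^sup>\<star> = y} \<inter> cball 0 \<rho>"
  have \<rho>: "0 \<le> \<rho>" "\<rho> < 1" "norm x + \<rho>\<^sup>2 = 2 * \<rho>"
    using x(3) by (auto simp: \<rho>_def power2_diff)
  have "complete S"
    unfolding S_def complete_eq_closed
    by (intro closed_Int closed_Collect_eq continuous_intros closed_cball cstar_subalgebraD(2)[OF \<A>]
        bounded_linear.continuous_on[OF bounded_linear_adj])
  \<comment> \<open>The fixed point theorem needs a nonempty set; \<open>0\<close> is reached as
    \<open>x - x\<close>.\<close>
  moreover have "0 \<in> S"
    using cstar_subalgebra_diff[OF \<A> x(1) x(1)] adj_diff[of x x] \<rho> by (simp add: S_def)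
  moreover have "f ` S \<subseteq> S"
  proof safe
    fix y assume y: "y \<in> S"
    have "norm (y * y) \<le> \<rho> * \<rho>"
      using y by (intro order_trans[OF norm_mult_ineq] mult_mono) (auto simp: S_def \<rho>)
    hence "norm (x + y * y) \<le> 2 * \<rho>"
      using norm_triangle_ineq[of x "y * y"] \<rho>(3) by (simp add: power2_eq_square)
    thus "f y \<in> S"
      using y x cstar_subalgebraD[OF \<A>] cstar_subalgebra_scaleR[OF \<A>]
      by (auto simp: f_def S_def adj_scaleR adj_add adj_mult)
  qed
  moreover have "\<forall>y\<in>S. \<forall>z\<in>S. dist (f y) (f z) \<le> \<rho> * dist y z"
  proof safe
    fix y z assume "y \<in> S" "z \<in> S"
    hence yz: "norm y \<le> \<rho>" "norm z \<le> \<rho>" by (auto simp: S_def)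
    \<comment> \<open>This splitting of \<open>y * y - z * z\<close> does not require
      \<open>y\<close> and \<open>z\<close> to commute. Each summand is at most
      \<open>\<rho> * norm (y - z)\<close>, so after halving the Lipschitz constant is
      \<open>\<rho> < 1\<close>.\<close>
    have "f y - f z = (1/2) *\<^sub>R (y * (y - z) + (y - z) * z)"
      by (simp add: f_def algebra_simps)
    hence "dist (f y) (f z) \<le> (norm (y * (y - z)) + norm ((y - z) * z)) / 2"
      by (simp add: dist_norm norm_triangle_ineq)
    also have "norm (y * (y - z)) \<le> \<rho> * norm (y - z)"
      by (rule order_trans[OF norm_mult_ineq]) (intro mult_right_mono yz norm_ge_zero)
    also have "norm ((y - z) * z) \<le> norm (y - z) * \<rho>"
      by (rule order_trans[OF norm_mult_ineq]) (intro mult_left_mono yz norm_ge_zero)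
    finally show "dist (f y) (f z) \<le> \<rho> * dist y z"
      by (simp add: dist_norm mult.commute)
  qed
  ultimately obtain y where y: "y \<in> S" "f y = y"
    using Banach_fix[of S \<rho> f] \<rho> by blast
  have "x + y * y = 2 *\<^sub>R y"
    using arg_cong[OF y(2), of "scaleR 2"] by (simp add: f_def)
  hence "(1 - y) * (1 - y) = 1 - x"
    by (simp add: algebra_simps scaleR_2)
  moreover have "1 - y \<in> \<A>" "(1 - y)\<^sup>\<star> = 1 - y"
    using y cstar_subalgebra_diff[OF \<A> cstar_subalgebraD(1)[OF \<A>]] by (auto simp: S_def adj_diff)
  ultimately show thesis using that by blast
qed

section \<open>Representations are contractive\<close>

lemma representationD:
  assumes "unital_representation \<A> \<pi>"
  shows "\<pi> 1 = 1" "a \<in> \<A> \<Longrightarrow> \<pi> (a\<^sup>\<star>) = (\<pi> a)\<^sup>\<star>" "a \<in> \<A> \<Longrightarrow> \<pi> (c *\<^sub>C a) = c *\<^sub>C \<pi> a"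
    "a \<in> \<A> \<Longrightarrow> b \<in> \<A> \<Longrightarrow> \<pi> (a + b) = \<pi> a + \<pi> b"
    "a \<in> \<A> \<Longrightarrow> b \<in> \<A> \<Longrightarrow> \<pi> (a * b) = \<pi> a * \<pi> b"
  using assms unfolding unital_representation_def by auto

lemma representation_scaleR:
  assumes "unital_representation \<A> \<pi>" "a \<in> \<A>"
  shows "\<pi> (r *\<^sub>R a) = r *\<^sub>R \<pi> a"
  using representationD(3)[OF assms, of "complex_of_real r"] by (simp add: scaleC_of_real)

lemma representation_diff:
  assumes "unital_cstar_subalgebra \<A>" "unital_representation \<A> \<pi>" "a \<in> \<A>" "b \<in> \<A>"
  shows "\<pi> (a - b) = \<pi> a - \<pi> b"
  using representationD(4)[OF assms(2,3) cstar_subalgebra_scaleR[OF assms(1,4), of "- 1"]]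
    representation_scaleR[OF assms(2,4), of "- 1"] by simp

text \<open>The equation \<open>b * b = 1 - a\<^sup>\<star> * a\<close> is algebraic, so \<pi>
  preserves it without any continuity assumption.\<close>

lemma representation_norm_le_one:
  assumes \<A>: "unital_cstar_subalgebra \<A>" and \<pi>: "unital_representation \<A> \<pi>"
    and a: "a \<in> \<A>" "norm a < 1"
  shows "norm (\<pi> a) \<le> 1"
proof -
  have "norm (a\<^sup>\<star> * a) \<le> norm a * norm a"
    using norm_mult_ineq[of "a\<^sup>\<star>" a] by simp
  also have "\<dots> < 1"
    using a(2) mult_strict_mono'[of "norm a" 1 "norm a" 1] by simp
  finally obtain b where b: "b \<in> \<A>" "b\<^sup>\<star> = b" "b * b = 1 - a\<^sup>\<star> * a"
    using cstar_subalgebra_sqrt_one_minus[OF \<A>, of "a\<^sup>\<star> * a"] a(1)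
    by (auto simp: adj_mult cstar_subalgebraD[OF \<A>])
  have eq: "(\<pi> b)\<^sup>\<star> * \<pi> b = 1 - (\<pi> a)\<^sup>\<star> * \<pi> a"
  proof -
    have "(\<pi> b)\<^sup>\<star> * \<pi> b = \<pi> (b * b)"
      using representationD[OF \<pi>] b by metis
    also have "\<dots> = 1 - (\<pi> a)\<^sup>\<star> * \<pi> a"
      unfolding b(3) using a(1) by (subst representation_diff[OF \<A> \<pi>])
        (auto simp: representationD[OF \<pi>] cstar_subalgebraD[OF \<A>])
    finally show ?thesis .
  qed
  show ?thesis
  proof (rule norm_bop_le)
    fix x
    have "(norm (bop_apply (\<pi> b) x))\<^sup>2 = inner x x - inner (bop_apply ((\<pi> a)\<^sup>\<star> * \<pi> a) x) x"
      by (simp only: inner_adj_self[symmetric] eq bop_apply_simps inner_diff_left)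
    also have "\<dots> = (norm x)\<^sup>2 - (norm (bop_apply (\<pi> a) x))\<^sup>2"
      by (simp only: inner_adj_self power2_norm_eq_inner)
    finally have "(norm (bop_apply (\<pi> a) x))\<^sup>2 \<le> (norm x)\<^sup>2"
      by (smt (verit) zero_le_power2)
    thus "norm (bop_apply (\<pi> a) x) \<le> 1 * norm x" by simp
  qed simp
qed

text \<open>The square root argument needs norm strictly below \<open>1\<close>, so \<open>a\<close>
  is divided by an arbitrary \<open>r > norm a\<close>.\<close>

lemma representation_contractive:
  assumes \<A>: "unital_cstar_subalgebra \<A>" and \<pi>: "unital_representation \<A> \<pi>" and a: "a \<in> \<A>"
  shows "norm (\<pi> a) \<le> norm a"
proof (rule dense_ge)
  fix r assume r: "norm a < r"
  hence "0 < r" using norm_ge_zero[of a] by linarith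
  hence "norm (\<pi> ((1 / r) *\<^sub>R a)) \<le> 1"
    using r by (intro representation_norm_le_one[OF \<A> \<pi>] cstar_subalgebra_scaleR[OF \<A> a]) simp
  thus "norm (\<pi> a) \<le> r"
    using \<open>0 < r\<close> by (simp add: representation_scaleR[OF \<pi> a])
qed

text \<open>Reduces a claim about \<pi> on a generated algebra to its generators. Contractivity of
  \<pi> supplies the closedness.\<close>

lemma cstar_subalgebra_vimage:
  assumes \<A>: "unital_cstar_subalgebra \<A>" and \<pi>: "unital_representation \<A> \<pi>"
    and \<B>: "unital_cstar_subalgebra \<B>"
  shows "unital_cstar_subalgebra {a \<in> \<A>. \<pi> a \<in> \<B>}"
proof -
  have "closed {a \<in> \<A>. \<pi> a \<in> \<B>}"
    unfolding closed_sequential_limits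
  proof (intro allI impI, elim conjE)
    fix X l assume X: "\<forall>n. X n \<in> {a \<in> \<A>. \<pi> a \<in> \<B>}" and l: "X \<longlonglongrightarrow> l"
    have lA: "l \<in> \<A>"
      using closed_sequentially[OF cstar_subalgebraD(2)[OF \<A>]] X l by blast
    have le: "norm (\<pi> (X n) - \<pi> l) \<le> norm (X n - l)" for n
      using X lA representation_contractive[OF \<A> \<pi> cstar_subalgebra_diff[OF \<A>, of "X n" l]]
      by (simp add: representation_diff[OF \<A> \<pi>])
    have "(\<lambda>n. \<pi> (X n)) \<longlonglongrightarrow> \<pi> l"
      by (rule LIM_zero_cancel, rule Lim_null_comparison[OF _ tendsto_norm_zero[OF LIM_zero[OF l]]])
        (simp add: le)
    hence "\<pi> l \<in> \<B>"
      using closed_sequentially[OF cstar_subalgebraD(2)[OF \<B>], of "\<lambda>n. \<pi> (X n)"] X by simp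
    with lA show "l \<in> {a \<in> \<A>. \<pi> a \<in> \<B>}" by simp
  qed
  thus ?thesis
    unfolding unital_cstar_subalgebra_def
    by (auto simp: representationD[OF \<pi>] cstar_subalgebraD[OF \<A>] cstar_subalgebraD[OF \<B>])
qed

section \<open>The Schwarz inequality for UCP maps\<close>

lemma ucpD:
  assumes "ucp \<phi>"
  shows "\<phi> (a + b) = \<phi> a + \<phi> b" "\<phi> (c *\<^sub>C a) = c *\<^sub>C \<phi> a" "\<phi> 1 = 1"
  using assms unfolding ucp_def by auto

lemma ucp_scaleR:
  assumes "ucp \<phi>"
  shows "\<phi> (r *\<^sub>R a) = r *\<^sub>R \<phi> a"
  using ucpD(2)[OF assms, of "complex_of_real r" a] by (simp add: scaleC_of_real)

lemma ucp_diff: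
  assumes "ucp \<phi>"
  shows "\<phi> (a - b) = \<phi> a - \<phi> b"
  using ucpD(1)[OF assms, of a "(- 1) *\<^sub>R b"] ucp_scaleR[OF assms, of "- 1" b] by simp

lemma cinner_zero_left [simp]: "cinner 0 x = 0" for x :: "'a :: chilbert_space"
  using cinner_add_left[of 0 0 x] by simp

lemma cinner_zero_right [simp]: "cinner x 0 = 0" for x :: "'a :: chilbert_space"
  using cinner_add_right[of x 0 0] by simp

lemma cinner_sum_left: "cinner (sum f S) x = (\<Sum>i\<in>S. cinner (f i) x)"
  for x :: "'a :: chilbert_space"
  by (induction S rule: infinite_finite_induct) (simp_all add: cinner_add_left)

lemma cinner_sum_right: "cinner x (sum f S) = (\<Sum>i\<in>S. cinner x (f i))"
  for x :: "'a :: chilbert_space"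
  by (induction S rule: infinite_finite_induct) (simp_all add: cinner_add_right)

text \<open>The quadratic form of a Gram matrix is the squared norm of
  \<open>\<Sum>i<n. bop_apply (a i) (x i)\<close>. The cases \<open>n = 1, 2, 3\<close> are used
  below.\<close>

lemma ucp_gram_nonneg:
  fixes n :: nat
  assumes "ucp \<phi>"
  shows "(\<Sum>i<n. cinner (\<Sum>j<n. bop_apply (\<phi> ((a i)\<^sup>\<star> * a j)) (x j)) (x i)) \<in> \<real>\<^sub>\<ge>\<^sub>0"
proof -
  have "positive_bop_matrix n (\<lambda>i j. (a i)\<^sup>\<star> * a j)"
    unfolding positive_bop_matrix_def
  proof
    fix x :: "nat \<Rightarrow> 'a"
    let ?v = "\<Sum>i<n. bop_apply (a i) (x i)"
    have "cinner (\<Sum>j<n. bop_apply ((a i)\<^sup>\<star> * a j) (x j)) (x i) = cinner ?v (bop_apply (a i) (x i))" for i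
      by (simp add: cinner_sum_left cinner_adj)
    hence "(\<Sum>i<n. cinner (\<Sum>j<n. bop_apply ((a i)\<^sup>\<star> * a j) (x j)) (x i)) = cinner ?v ?v"
      by (simp only: cinner_sum_right)
    thus "(\<Sum>i<n. cinner (\<Sum>j<n. bop_apply ((a i)\<^sup>\<star> * a j) (x j)) (x i)) \<in> \<real>\<^sub>\<ge>\<^sub>0"
      by (simp add: cinner_self)
  qed
  hence "positive_bop_matrix n (\<lambda>i j. \<phi> ((a i)\<^sup>\<star> * a j))"
    using assms unfolding ucp_def completely_positive_def by blast
  thus ?thesis
    unfolding positive_bop_matrix_def by blast
qed

lemma ucp_positive:
  assumes "ucp \<phi>"
  shows "cinner (bop_apply (\<phi> (a\<^sup>\<star> * a)) u) u \<in> \<real>\<^sub>\<ge>\<^sub>0"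
  using ucp_gram_nonneg[OF assms, of "\<lambda>_. a" "\<lambda>_. u" 1] by simp

text \<open>Positivity makes the quadratic form of a \<open>2 \<times> 2\<close> Gram matrix real,
  and this reality forces compatibility with the adjoint.\<close>

lemma ucp_adj:
  assumes \<phi>: "ucp \<phi>"
  shows "\<phi> (a\<^sup>\<star>) = (\<phi> a)\<^sup>\<star>"
proof -
  have Im: "Im (cinner (bop_apply (\<phi> a) u) v) = Im (cinner u (bop_apply (\<phi> (a\<^sup>\<star>)) v))" for u v
  proof -
    \<comment> \<open>The Gram matrix of \<open>1, a\<close> is evaluated at \<open>(v, u)\<close>.
      Its diagonal terms are real, so the sum of the two cross terms is real too.\<close>
    have "Im (cinner (bop_apply (\<phi> a) u) v) + Im (cinner (bop_apply (\<phi> (a\<^sup>\<star>)) v) u) = 0"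
      using ucp_gram_nonneg[OF \<phi>, of "\<lambda>i. if i = 0 then 1 else a" "\<lambda>i. if i = 0 then v else u" 2]
        ucp_positive[OF \<phi>, of a u]
      by (simp add: numeral_2_eq_2 lessThan_Suc ucpD[OF \<phi>] cinner_add_left cinner_self
          complex_nonneg_Reals_iff)
    thus ?thesis
      using arg_cong[OF cinner_commute[of u "bop_apply (\<phi> (a\<^sup>\<star>)) v"], of Im] by simp
  qed
  show ?thesis
  proof (rule sym, rule adj_unique, rule complex_eqI)
    fix u v
    show "Im (cinner (bop_apply (\<phi> a) u) v) = Im (cinner u (bop_apply (\<phi> (a\<^sup>\<star>)) v))" by (rule Im)
    \<comment> \<open>Multiplying \<open>u\<close> by \<open>\<i>\<close> turns the identity of
      imaginary parts into one of real parts.\<close>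
    show "Re (cinner (bop_apply (\<phi> a) u) v) = Re (cinner u (bop_apply (\<phi> (a\<^sup>\<star>)) v))"
      using Im[of "\<i> *\<^sub>C u" v] by (simp add: bop_apply_scaleC cinner_scaleC_left)
  qed
qed

text \<open>The operator \<open>M\<close> below is positive because \<open>norm y\<close> bounds
  \<open>y\<close>; a positive unital map preserves this inequality.\<close>

lemma ucp_adj_mult_le:
  assumes \<phi>: "ucp \<phi>"
  shows "inner (bop_apply (\<phi> (y\<^sup>\<star> * y)) u) u \<le> (norm y)\<^sup>2 * (norm u)\<^sup>2"
proof -
  define M where "M = (norm y)\<^sup>2 *\<^sub>R 1 - y\<^sup>\<star> * y"
  have "cinner (bop_apply M x) x \<in> \<real>\<^sub>\<ge>\<^sub>0" for x
  proof -
    have "inner (bop_apply M x) x = (norm y)\<^sup>2 * (norm x)\<^sup>2 - inner (bop_apply (y\<^sup>\<star> * y) x) x"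
      unfolding M_def bop_apply_simps(4) inner_diff_left
      by (simp only: bop_apply_simps inner_scaleR_left power2_norm_eq_inner)
    also have "\<dots> = (norm y * norm x)\<^sup>2 - (norm (bop_apply y x))\<^sup>2"
      by (simp only: inner_adj_self power_mult_distrib)
    also have "\<dots> \<ge> 0"
      using power_mono[OF norm_bop_apply[of y x], of 2] by simp
    finally have "0 \<le> Re (cinner (bop_apply M x) x)"
      by (simp only: inner_eq_Re_cinner)
    moreover have "M\<^sup>\<star> = M"
      by (simp add: M_def adj_diff adj_scaleR adj_mult)
    hence "Im (cinner (bop_apply M x) x) = 0"
      using arg_cong[OF cinner_commute[of "bop_apply M x" x], of Im] by (simp add: cinner_adj)
    ultimately show ?thesis
      by (simp add: complex_nonneg_Reals_iff)
  qed
  hence "positive_bop_matrix 1 (\<lambda>_ _. M)"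
    by (simp add: positive_bop_matrix_def)
  hence "positive_bop_matrix 1 (\<lambda>_ _. \<phi> M)"
    using \<phi> unfolding ucp_def completely_positive_def by blast
  hence "cinner (bop_apply (\<phi> M) u) u \<in> \<real>\<^sub>\<ge>\<^sub>0"
    unfolding positive_bop_matrix_def by (auto dest: spec[of _ "\<lambda>_. u"])
  hence "0 \<le> inner (bop_apply (\<phi> M) u) u"
    by (simp add: complex_nonneg_Reals_iff inner_eq_Re_cinner)
  moreover have "\<phi> M = (norm y)\<^sup>2 *\<^sub>R 1 - \<phi> (y\<^sup>\<star> * y)"
    by (simp add: M_def ucp_diff[OF \<phi>] ucp_scaleR[OF \<phi>] ucpD(3)[OF \<phi>])
  ultimately show ?thesis
    by (simp add: inner_diff_left power2_norm_eq_inner)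
qed

text \<open>
  The \<open>3 \<times> 3\<close> Gram matrix of \<open>1, x\<^sup>\<star>, y\<close> is positive; evaluating its image at
  \<open>(- \<phi>(x\<^sup>\<star>) u - \<phi>(y) v, u, v)\<close> completes the square.
\<close>

lemma ucp_defect_nonneg:
  assumes \<phi>: "ucp \<phi>"
  shows "0 \<le> inner (bop_apply (\<phi> (x * x\<^sup>\<star>) - \<phi> x * \<phi> (x\<^sup>\<star>)) u) u
    + 2 * inner (bop_apply (\<phi> (x * y) - \<phi> x * \<phi> y) v) u
    + inner (bop_apply (\<phi> (y\<^sup>\<star> * y) - \<phi> (y\<^sup>\<star>) * \<phi> y) v) v"
proof -
  define w where "w = - (bop_apply (\<phi> (x\<^sup>\<star>)) u + bop_apply (\<phi> y) v)"
  define a where "a i = (if i = 0 then 1 else if i = 1 then x\<^sup>\<star> else y)" for i :: nat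
  define \<xi> where "\<xi> i = (if i = 0 then w else if i = 1 then u else v)" for i :: nat
  interpret x: bounded_linear "bop_apply (\<phi> x)" by (rule bounded_linear_bop_apply)
  interpret y: bounded_linear "bop_apply (\<phi> (y\<^sup>\<star>))" by (rule bounded_linear_bop_apply)
  \<comment> \<open>The two off-diagonal defects are adjoint to each other, hence equal in the real
    inner product; this produces the factor \<open>2\<close>.\<close>
  have sym: "inner (bop_apply (\<phi> (y\<^sup>\<star> * x\<^sup>\<star>) - \<phi> (y\<^sup>\<star>) * \<phi> (x\<^sup>\<star>)) u) v
      = inner (bop_apply (\<phi> (x * y) - \<phi> x * \<phi> y) v) u"
  proof -
    have "\<phi> (y\<^sup>\<star> * x\<^sup>\<star>) - \<phi> (y\<^sup>\<star>) * \<phi> (x\<^sup>\<star>) = (\<phi> (x * y) - \<phi> x * \<phi> y)\<^sup>\<star>"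
      by (simp only: adj_diff adj_mult ucp_adj[OF \<phi>, symmetric])
    thus ?thesis
      by (metis inner_bop_adj inner_commute)
  qed
  have "0 \<le> Re (\<Sum>i<3. cinner (\<Sum>j<3. bop_apply (\<phi> ((a i)\<^sup>\<star> * a j)) (\<xi> j)) (\<xi> i))"
    using ucp_gram_nonneg[OF \<phi>, where n = 3 and a = a and x = \<xi>]
    by (simp only: complex_nonneg_Reals_iff)
  also have "\<dots> = inner (w + bop_apply (\<phi> (x\<^sup>\<star>)) u + bop_apply (\<phi> y) v) w
    + inner (bop_apply (\<phi> x) w + bop_apply (\<phi> (x * x\<^sup>\<star>)) u + bop_apply (\<phi> (x * y)) v) u
    + inner (bop_apply (\<phi> (y\<^sup>\<star>)) w + bop_apply (\<phi> (y\<^sup>\<star> * x\<^sup>\<star>)) u + bop_apply (\<phi> (y\<^sup>\<star> * y)) v) v"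
    by (simp add: numeral_3_eq_3 lessThan_Suc a_def \<xi>_def inner_eq_Re_cinner ucpD(3)[OF \<phi>]
        cinner_add_left)
  \<comment> \<open>The choice of \<open>w\<close> annihilates the first row and creates the
    products subtracted in the other two.\<close>
  also have "w + bop_apply (\<phi> (x\<^sup>\<star>)) u + bop_apply (\<phi> y) v = 0"
    by (simp add: w_def)
  also have "bop_apply (\<phi> x) w + bop_apply (\<phi> (x * x\<^sup>\<star>)) u + bop_apply (\<phi> (x * y)) v
    = bop_apply (\<phi> (x * x\<^sup>\<star>) - \<phi> x * \<phi> (x\<^sup>\<star>)) u + bop_apply (\<phi> (x * y) - \<phi> x * \<phi> y) v"
    by (simp add: w_def x.diff x.neg x.add)
  also have "bop_apply (\<phi> (y\<^sup>\<star>)) w + bop_apply (\<phi> (y\<^sup>\<star> * x\<^sup>\<star>)) u + bop_apply (\<phi> (y\<^sup>\<star> * y)) v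
    = bop_apply (\<phi> (y\<^sup>\<star> * x\<^sup>\<star>) - \<phi> (y\<^sup>\<star>) * \<phi> (x\<^sup>\<star>)) u
      + bop_apply (\<phi> (y\<^sup>\<star> * y) - \<phi> (y\<^sup>\<star>) * \<phi> y) v"
    by (simp add: w_def y.diff y.neg y.add)
  finally show ?thesis
    by (simp only: inner_add_left sym inner_zero_left)
qed

text \<open>For \<open>e > 0\<close> the value \<open>t = e\<close> suffices. For
  \<open>e = 0\<close>, the minimiser \<open>t = p / q\<close>, or \<open>t = 1\<close> when
  \<open>q = 0\<close>, forces \<open>p = 0\<close>.\<close>

lemma le_mult_of_quadratic_nonneg:
  fixes e p q :: real
  assumes "0 \<le> e" "0 \<le> p" "0 \<le> q" and quad: "\<And>t. 0 \<le> e * p - 2 * t * p + t\<^sup>2 * q"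
  shows "p \<le> e * q"
proof (cases "e = 0")
  case False
  have "e * p \<le> e * (e * q)"
    using quad[of e] by (simp add: power2_eq_square algebra_simps)
  thus ?thesis using False assms(1) by simp
next
  case e: True
  have "0 \<le> - (p\<^sup>2 / q)" if "q \<noteq> 0"
    using quad[of "p / q"] e that by (simp add: power2_eq_square)
  hence "p = 0" if "q \<noteq> 0"
    using that assms(3) by (simp add: field_simps)
  moreover have "p = 0" if "q = 0"
    using quad[of 1] assms(2) e that by simp
  ultimately show ?thesis using e by auto
qed

text \<open>The block inequality is tested at \<open>u = bop_apply ?D v\<close> with
  \<open>v\<close> replaced by \<open>(- t) *\<^sub>R v\<close>; the mixed term becomes the squared
  norm of \<open>?D v\<close>, and varying \<open>t\<close> gives the bound.\<close>

lemma ucp_schwarz: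
  assumes \<phi>: "ucp \<phi>"
  shows "(norm (\<phi> (x * y) - \<phi> x * \<phi> y))\<^sup>2 \<le> norm (\<phi> (x * x\<^sup>\<star>) - \<phi> x * \<phi> (x\<^sup>\<star>)) * (norm y)\<^sup>2"
    (is "(norm ?D)\<^sup>2 \<le> norm ?E * _")
proof -
  have "(norm (bop_apply ?D v))\<^sup>2 \<le> norm ?E * ((norm y)\<^sup>2 * (norm v)\<^sup>2)" for v
  proof (rule le_mult_of_quadratic_nonneg)
    fix t :: real
    let ?u = "bop_apply ?D v" and ?F = "\<phi> (y\<^sup>\<star> * y) - \<phi> (y\<^sup>\<star>) * \<phi> y"
    have "0 \<le> inner (bop_apply ?E ?u) ?u + 2 * inner (bop_apply ?D ((- t) *\<^sub>R v)) ?u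
      + inner (bop_apply ?F ((- t) *\<^sub>R v)) ((- t) *\<^sub>R v)"
      by (rule ucp_defect_nonneg[OF \<phi>])
    also have "\<dots> = inner (bop_apply ?E ?u) ?u - 2 * t * (norm ?u)\<^sup>2 + t\<^sup>2 * inner (bop_apply ?F v) v"
      unfolding linear_scale[OF bounded_linear.linear[OF bounded_linear_bop_apply]]
        inner_scaleR_left inner_scaleR_right power2_norm_eq_inner
      by (simp add: power2_eq_square)
    also have "inner (bop_apply ?E ?u) ?u \<le> norm ?E * (norm ?u)\<^sup>2"
      by (rule order_trans[OF norm_cauchy_schwarz], unfold power2_eq_square mult.assoc[symmetric])
        (intro mult_right_mono norm_bop_apply norm_ge_zero)
    \<comment> \<open>The subtracted product is \<open>(\<phi> y)\<^sup>\<star> * \<phi> y\<close>,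
      which is positive, so dropping it only enlarges the form.\<close>
    also have "inner (bop_apply ?F v) v \<le> (norm y)\<^sup>2 * (norm v)\<^sup>2"
    proof -
      have "inner (bop_apply (\<phi> (y\<^sup>\<star>) * \<phi> y) v) v = (norm (bop_apply (\<phi> y) v))\<^sup>2"
        by (simp only: inner_adj_self ucp_adj[OF \<phi>])
      thus ?thesis
        using ucp_adj_mult_le[OF \<phi>, of y v]
        unfolding bop_apply_simps(4) inner_diff_left by (smt (verit) zero_le_power2)
    qed
    finally show "0 \<le> norm ?E * (norm ?u)\<^sup>2 - 2 * t * (norm ?u)\<^sup>2 + t\<^sup>2 * ((norm y)\<^sup>2 * (norm v)\<^sup>2)"
      by (simp add: mult_left_mono)
  qed simp_all
  hence "norm (bop_apply ?D v) \<le> sqrt (norm ?E * (norm y)\<^sup>2) * norm v" for v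
    using real_le_rsqrt[of "norm (bop_apply ?D v)" "norm ?E * ((norm y)\<^sup>2 * (norm v)\<^sup>2)"]
    by (simp add: real_sqrt_mult mult.assoc)
  hence "norm ?D \<le> sqrt (norm ?E * (norm y)\<^sup>2)"
    by (intro norm_bop_le) simp_all
  hence "(norm ?D)\<^sup>2 \<le> (sqrt (norm ?E * (norm y)\<^sup>2))\<^sup>2"
    by (intro power_mono) simp_all
  thus ?thesis by simp
qed

text \<open>At \<open>u = 0\<close> only the last term of the block inequality survives: it is the
  Kadison-Schwarz inequality for \<open>y\<^sup>\<star> * y\<close>.\<close>

lemma ucp_contractive:
  assumes \<phi>: "ucp \<phi>"
  shows "norm (\<phi> y) \<le> norm y"
proof (rule norm_bop_le)
  fix v
  have "0 \<le> inner (bop_apply (\<phi> (y\<^sup>\<star> * y)) v) v - (norm (bop_apply (\<phi> y) v))\<^sup>2"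
    using ucp_defect_nonneg[OF \<phi>, of 0 0 y v]
    unfolding ucp_adj[OF \<phi>] bop_apply_simps(4) inner_diff_left inner_adj_self by simp
  hence "(norm (bop_apply (\<phi> y) v))\<^sup>2 \<le> (norm y * norm v)\<^sup>2"
    using ucp_adj_mult_le[OF \<phi>, of y v] by (simp add: power_mult_distrib)
  thus "norm (bop_apply (\<phi> y) v) \<le> norm y * norm v"
    by simp
qed simp

section \<open>Asymptotic multiplicative domains\<close>

text \<open>An asymptotic, one-sided multiplicative domain. Having \<open>a\<close> itself outside,
  rather than \<open>\<phi> n a\<close>, lets \<open>y = 1\<close> express convergence at
  \<open>a\<close>.\<close>

definition left_domain :: "(nat \<Rightarrow> 'l::chilbert_space bop \<Rightarrow> 'l bop) \<Rightarrow> 'l bop set"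
  where "left_domain \<phi> = {a. \<forall>y. (\<lambda>n. \<phi> n (a * y) - a * \<phi> n y) \<longlonglongrightarrow> 0}"

lemma left_domain_converges:
  assumes "\<And>n. ucp (\<phi> n)" "a \<in> left_domain \<phi>"
  shows "(\<lambda>n. norm (\<phi> n a - a)) \<longlonglongrightarrow> 0"
proof -
  have "(\<lambda>n. \<phi> n (a * 1) - a * \<phi> n 1) \<longlonglongrightarrow> 0"
    using assms(2) unfolding left_domain_def by blast
  thus ?thesis
    by (intro tendsto_norm_zero) (simp add: ucpD(3)[OF assms(1)])
qed

text \<open>Contractivity is uniform in \<open>n\<close>, so replacing \<open>a\<close> by a nearby
  \<open>b\<close> costs at most \<open>2 * norm (a - b) * norm y\<close> for all \<open>n\<close>
  at once.\<close>

lemma closed_left_domain: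
  assumes \<phi>: "\<And>n. ucp (\<phi> n)"
  shows "closed (left_domain \<phi>)"
  unfolding closure_subset_eq[symmetric]
proof
  fix a assume "a \<in> closure (left_domain \<phi>)"
  hence approx: "\<forall>e>0. \<exists>b\<in>left_domain \<phi>. dist b a < e"
    by (simp add: closure_approachable)
  have "(\<lambda>n. \<phi> n (a * y) - a * \<phi> n y) \<longlonglongrightarrow> 0" for y
  proof (rule LIMSEQ_I)
    fix r :: real assume r: "0 < r"
    \<comment> \<open>The two replacement errors each stay below \<open>r / 4\<close>; adding
      \<open>1\<close> covers \<open>y = 0\<close>.\<close>
    define e where "e = r / (4 * (norm y + 1))"
    have pos: "0 < norm y + 1" by (simp add: add_nonneg_pos)
    hence e: "0 < e" "e * norm y < r / 4"
      using r by (auto simp: e_def field_simps)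
    obtain b where b: "b \<in> left_domain \<phi>" "norm (a - b) < e"
      using approx e(1) by (auto simp: dist_norm norm_minus_commute)
    have "(\<lambda>n. \<phi> n (b * y) - b * \<phi> n y) \<longlonglongrightarrow> 0"
      using b(1) unfolding left_domain_def by blast
    then obtain N where N: "\<And>n. N \<le> n \<Longrightarrow> norm (\<phi> n (b * y) - b * \<phi> n y) < r / 2"
      using LIMSEQ_D[of _ 0 "r / 2"] r by auto
    show "\<exists>N. \<forall>n\<ge>N. norm (\<phi> n (a * y) - a * \<phi> n y - 0) < r"
    proof (intro exI allI impI)
      fix n assume n: "N \<le> n"
      have le: "norm (a - b) * norm y \<le> e * norm y"
        using b(2) by (intro mult_right_mono) auto
      have "norm (\<phi> n ((a - b) * y)) \<le> norm (a - b) * norm y"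
        by (rule order_trans[OF ucp_contractive[OF \<phi>] norm_mult_ineq])
      moreover have "norm ((a - b) * \<phi> n y) \<le> norm (a - b) * norm y"
        by (rule order_trans[OF norm_mult_ineq]) (intro mult_left_mono ucp_contractive \<phi> norm_ge_zero)
      moreover have "\<phi> n (a * y) - a * \<phi> n y
        = (\<phi> n ((a - b) * y) - (a - b) * \<phi> n y) + (\<phi> n (b * y) - b * \<phi> n y)"
        by (simp add: left_diff_distrib ucp_diff[OF \<phi>])
      hence "norm (\<phi> n (a * y) - a * \<phi> n y)
        \<le> norm (\<phi> n ((a - b) * y)) + norm ((a - b) * \<phi> n y) + norm (\<phi> n (b * y) - b * \<phi> n y)"
        by (simp only:) (intro order_trans[OF norm_triangle_ineq] add_right_mono norm_triangle_ineq4)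
      ultimately show "norm (\<phi> n (a * y) - a * \<phi> n y - 0) < r"
        using le e(2) N[OF n] by simp
    qed
  qed
  thus "a \<in> left_domain \<phi>" by (simp add: left_domain_def)
qed

text \<open>The one-sided condition is stable under sums, products, scalars and limits; requiring it
  of the adjoint too makes the set self-adjoint.\<close>

lemma cstar_subalgebra_left_domain:
  assumes \<phi>: "\<And>n. ucp (\<phi> n)"
  shows "unital_cstar_subalgebra {a. a \<in> left_domain \<phi> \<and> a\<^sup>\<star> \<in> left_domain \<phi>}"
proof -
  have one: "1 \<in> left_domain \<phi>"
    by (simp add: left_domain_def)
  have add: "a + b \<in> left_domain \<phi>" if "a \<in> left_domain \<phi>" "b \<in> left_domain \<phi>" for a b
  proof -
    have "(\<lambda>n. (\<phi> n (a * y) - a * \<phi> n y) + (\<phi> n (b * y) - b * \<phi> n y)) \<longlonglongrightarrow> 0" for y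
      using that unfolding left_domain_def by (intro tendsto_add_zero) auto
    thus ?thesis
      by (simp add: left_domain_def ucpD(1)[OF \<phi>] distrib_right add_diff_add)
  qed
  have mult: "a * b \<in> left_domain \<phi>" if "a \<in> left_domain \<phi>" "b \<in> left_domain \<phi>" for a b
  proof -
    \<comment> \<open>The intermediate term \<open>a * \<phi> n (b * y)\<close> is inserted:
      membership of \<open>a\<close> is used at \<open>b * y\<close>, that of \<open>b\<close> at
      \<open>y\<close>.\<close>
    have "(\<lambda>n. (\<phi> n (a * (b * y)) - a * \<phi> n (b * y)) + a * (\<phi> n (b * y) - b * \<phi> n y)) \<longlonglongrightarrow> 0" for y
      using that unfolding left_domain_def by (intro tendsto_add_zero tendsto_mult_right_zero) auto
    thus ?thesis
      by (simp add: left_domain_def right_diff_distrib mult.assoc)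
  qed
  have scale: "c *\<^sub>C a \<in> left_domain \<phi>" if "a \<in> left_domain \<phi>" for c a
  proof -
    have "(\<lambda>n. c *\<^sub>C (\<phi> n (a * y) - a * \<phi> n y)) \<longlonglongrightarrow> 0" for y
    proof (rule Lim_null_comparison)
      have "(\<lambda>n. norm (\<phi> n (a * y) - a * \<phi> n y)) \<longlonglongrightarrow> 0"
        using that unfolding left_domain_def by (intro tendsto_norm_zero) auto
      thus "(\<lambda>n. cmod c * norm (\<phi> n (a * y) - a * \<phi> n y)) \<longlonglongrightarrow> 0"
        by (rule tendsto_mult_right_zero)
    qed (simp add: norm_scaleC_bop)
    thus ?thesis
      by (simp add: left_domain_def scaleC_mult_left ucpD(2)[OF \<phi>] scaleC_diff_right_bop)
  qed
  have "closed (left_domain \<phi> \<inter> adj -` left_domain \<phi>)"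
    by (intro closed_Int closed_vimage closed_left_domain \<phi>
        bounded_linear.continuous_on[OF bounded_linear_adj] continuous_on_id)
  hence "closed {a. a \<in> left_domain \<phi> \<and> a\<^sup>\<star> \<in> left_domain \<phi>}"
    by (simp add: vimage_def Collect_conj_eq)
  thus ?thesis
    unfolding unital_cstar_subalgebra_def
    by (auto simp: one add mult scale adj_add adj_mult adj_scaleC)
qed

text \<open>Convergence at \<open>x\<close> and at \<open>x * x\<^sup>\<star>\<close> makes the
  first factor of the Schwarz bound tend to \<open>0\<close>, whatever \<open>y\<close> is.\<close>

lemma left_domainI:
  assumes \<phi>: "\<And>n. ucp (\<phi> n)"
    and x: "(\<lambda>n. \<phi> n x) \<longlonglongrightarrow> x" and xx: "(\<lambda>n. \<phi> n (x * x\<^sup>\<star>)) \<longlonglongrightarrow> x * x\<^sup>\<star>"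
  shows "x \<in> left_domain \<phi>"
proof -
  have "(\<lambda>n. \<phi> n (x\<^sup>\<star>)) \<longlonglongrightarrow> x\<^sup>\<star>"
    unfolding ucp_adj[OF \<phi>] by (rule bounded_linear.tendsto[OF bounded_linear_adj x])
  hence "(\<lambda>n. \<phi> n (x * x\<^sup>\<star>) - \<phi> n x * \<phi> n (x\<^sup>\<star>)) \<longlonglongrightarrow> x * x\<^sup>\<star> - x * x\<^sup>\<star>"
    by (intro tendsto_intros x xx)
  hence E: "(\<lambda>n. norm (\<phi> n (x * x\<^sup>\<star>) - \<phi> n x * \<phi> n (x\<^sup>\<star>))) \<longlonglongrightarrow> 0"
    by (intro tendsto_norm_zero) simp
  have "(\<lambda>n. \<phi> n (x * y) - x * \<phi> n y) \<longlonglongrightarrow> 0" for y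
  proof -
    have "(\<lambda>n. \<phi> n (x * y) - \<phi> n x * \<phi> n y) \<longlonglongrightarrow> 0"
    proof (rule Lim_null_comparison)
      let ?b = "\<lambda>n. sqrt (norm (\<phi> n (x * x\<^sup>\<star>) - \<phi> n x * \<phi> n (x\<^sup>\<star>)) * (norm y)\<^sup>2)"
      have "?b \<longlonglongrightarrow> sqrt (0 * (norm y)\<^sup>2)"
        by (intro tendsto_intros E)
      thus "?b \<longlonglongrightarrow> 0" by simp
    qed (simp add: real_le_rsqrt ucp_schwarz \<phi>)
    \<comment> \<open>This replaces the factor \<open>\<phi> n x\<close> by \<open>x\<close>;
      \<open>\<phi> n y\<close> stays bounded by \<open>norm y\<close>.\<close>
    moreover have "(\<lambda>n. (\<phi> n x - x) * \<phi> n y) \<longlonglongrightarrow> 0"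
    proof (rule Lim_null_comparison)
      show "(\<lambda>n. norm (\<phi> n x - x) * norm y) \<longlonglongrightarrow> 0"
        by (intro tendsto_mult_left_zero tendsto_norm_zero LIM_zero x)
    qed (intro always_eventually allI order_trans[OF norm_mult_ineq] mult_left_mono
          ucp_contractive \<phi> norm_ge_zero)
    ultimately have "(\<lambda>n. (\<phi> n (x * y) - \<phi> n x * \<phi> n y) + (\<phi> n x - x) * \<phi> n y) \<longlonglongrightarrow> 0"
      by (rule tendsto_add_zero)
    thus ?thesis by (simp add: left_diff_distrib)
  qed
  thus ?thesis by (simp add: left_domain_def)
qed

section \<open>Hyperrigidity, by pulling the asymptotic domain back along the representation\<close>

theorem corollary4p2:
  fixes T :: "'h::chilbert_space bop" and \<A> \<G> :: "'h bop set"
  assumes "separable_space (euclidean :: 'h topology)"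
    and "normal_bop T"
    and "\<A> = unital_cstar_generated {T}"
    and "\<G> = {T, T * T\<^sup>\<star>}"
  shows "hyperrigid_generator TYPE('l::chilbert_space) \<G> \<A>"
proof -
  have \<A>: "unital_cstar_subalgebra \<A>"
    unfolding assms(3) by (rule cstar_subalgebra_generated)
  have T: "T \<in> \<A>" "T\<^sup>\<star> \<in> \<A>" "T * T\<^sup>\<star> \<in> \<A>"
    using generated_superset[of "{T}"] cstar_subalgebraD[OF \<A>] unfolding assms(3) by auto
  have "unital_cstar_generated \<G> = \<A>"
    using generated_insert[of "T * T\<^sup>\<star>" "{T}"] T(3) unfolding assms(3,4)
    by (simp add: insert_commute)
  moreover have "countable \<G>"
    by (simp add: assms(4))
  moreover have "(\<lambda>n. norm (\<phi> n (\<pi> a) - \<pi> a)) \<longlonglongrightarrow> 0"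
    if rep: "faithful_representation \<A> \<pi>" and ucp: "\<forall>n. ucp (\<phi> n)"
      and lim: "\<forall>g\<in>\<G>. (\<lambda>n. norm (\<phi> n (\<pi> g) - \<pi> g)) \<longlonglongrightarrow> 0" and a: "a \<in> \<A>"
    for \<pi> :: "'h bop \<Rightarrow> 'l bop" and \<phi> :: "nat \<Rightarrow> 'l bop \<Rightarrow> 'l bop" and a
  proof -
    define t where "t = \<pi> T"
    define \<B> where "\<B> = {b. b \<in> left_domain \<phi> \<and> b\<^sup>\<star> \<in> left_domain \<phi>}"
    have \<phi>: "ucp (\<phi> n)" for n using ucp by blast
    have \<pi>: "unital_representation \<A> \<pi>"
      using rep by (simp add: faithful_representation_def)
    have star: "\<pi> (T * T\<^sup>\<star>) = t * t\<^sup>\<star>" "t * t\<^sup>\<star> = t\<^sup>\<star> * t"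
      using assms(2) representationD(2,5)[OF \<pi>] T unfolding t_def normal_bop_def by metis+
    have lim_t: "(\<lambda>n. \<phi> n t) \<longlonglongrightarrow> t" and lim_tt: "(\<lambda>n. \<phi> n (t * t\<^sup>\<star>)) \<longlonglongrightarrow> t * t\<^sup>\<star>"
      using lim star(1) by (auto simp: assms(4) t_def tendsto_norm_zero_iff LIM_zero_iff)
    have "(\<lambda>n. \<phi> n (t\<^sup>\<star>)) \<longlonglongrightarrow> t\<^sup>\<star>"
      unfolding ucp_adj[OF \<phi>] by (rule bounded_linear.tendsto[OF bounded_linear_adj lim_t])
    \<comment> \<open>Normality enters here: for \<open>x = t\<^sup>\<star>\<close> the product
      \<open>x * x\<^sup>\<star>\<close> is again \<open>t * t\<^sup>\<star>\<close>, so the same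
      limit serves both memberships.\<close>
    hence "t \<in> \<B>"
      using left_domainI[OF \<phi> lim_t lim_tt] left_domainI[OF \<phi>, where x = "t\<^sup>\<star>"] lim_tt star(2)
      by (simp add: \<B>_def)
    \<comment> \<open>The preimage of \<open>\<B>\<close> is a C*-subalgebra containing
      \<open>T\<close>, hence all of \<open>\<A>\<close>.\<close>
    hence "unital_cstar_generated {T} \<subseteq> {a \<in> \<A>. \<pi> a \<in> \<B>}"
      using T(1) cstar_subalgebra_left_domain[OF \<phi>]
      by (intro generated_minimal cstar_subalgebra_vimage[OF \<A> \<pi>]) (auto simp: \<B>_def t_def)
    hence "\<pi> a \<in> left_domain \<phi>"
      using a by (auto simp: assms(3) \<B>_def)
    thus ?thesis
      by (rule left_domain_converges[OF \<phi>])
  qed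
  ultimately show ?thesis
    unfolding hyperrigid_generator_def by blast
qed

end
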